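(* Let $\alpha>1$ and let $f:\mathbb{R}^n\to\mathbb{R}$ be a continuously differentiable function satisfying the $\alpha$-PL condition. If the set of minima $\{x\in\mathbb{R}^n : f(x)=\min_{x'} f(x')\}$ is bounded, then for all $c\in\mathbb{R}$ the sublevel set $L^-_c=\{x\in\mathbb{R}^n : f(x)\le c\}$ is connected, including the set of minima.
   Context: A differentiable function $f:\mathbb{R}^n\to\mathbb{R}$ (attaining its minimum) satisfies the $\alpha$-PL condition if there exists a constant $\mu>0$ such that $\|\nabla f(x)\|^\alpha\ge\mu\,(f(x)-\min_{x'}f(x'))$ for all $x\in\mathbb{R}^n$. The empty set is regarded as connected. *)

theory Defs
  imports "HOL-Analysis.Analysis"
begin

text \<open>Only meaningful at points of differentiability.\<close>

definition grad :: "(real ^ 'n \<Rightarrow> real) \<Rightarrow> real ^ 'n \<Rightarrow> real ^ 'n" where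
  "grad f x = (THE D. GDERIV f x :> D)"

lemma GDERIV_grad:
  fixes f :: "real ^ 'n \<Rightarrow> real"
  assumes "f differentiable (at x)"
  shows "GDERIV f x :> grad f x"
proof -
  obtain f' where f': "(f has_derivative f') (at x)"
    using assms by (auto simp: differentiable_def)
  have lin: "linear f'"
    using f' by (rule has_derivative_linear)
  have "f' h = inner h (adjoint f' 1)" for h
    using adjoint_works[OF lin, of h 1] by simp
  then have "f' = (\<lambda>h. inner h (adjoint f' 1))"
    by (rule ext)
  then have ex: "GDERIV f x :> adjoint f' 1"
    unfolding gderiv_def by (rule subst[where P = "\<lambda>g. (f has_derivative g) (at x)"]) (rule f')
  have "D = adjoint f' 1" if "GDERIV f x :> D" for D
  proof -
    have "(\<lambda>h. inner h D) = (\<lambda>h. inner h (adjoint f' 1))"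
      using that ex unfolding gderiv_def by (rule has_derivative_unique)
    then have "\<forall>h. inner h D = inner h (adjoint f' 1)"
      by (rule fun_cong[THEN allI])
    then show ?thesis
      by (simp only: vector_eq_ldot)
  qed
  then show ?thesis
    unfolding grad_def by (rule theI[where P = "\<lambda>D. GDERIV f x :> D", OF ex])
qed

definition continuously_differentiable :: "(real ^ 'n \<Rightarrow> real) \<Rightarrow> bool" where
  "continuously_differentiable f \<longleftrightarrow>
     (\<forall>x. f differentiable (at x)) \<and> continuous_on UNIV (grad f)"

definition attains_min :: "('a \<Rightarrow> real) \<Rightarrow> bool" where
  "attains_min f \<longleftrightarrow> (\<exists>x. \<forall>y. f x \<le> f y)"

text \<open>Only meaningful if the minimum is attained.\<close>

definition min_value :: "('a \<Rightarrow> real) \<Rightarrow> real" where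
  "min_value f = (LEAST v. v \<in> range f)"

lemma min_value_eqI: "(\<And>y. f x \<le> f y) \<Longrightarrow> min_value f = f x"
  unfolding min_value_def by (rule Least_equality) auto

definition PL_condition :: "real \<Rightarrow> (real ^ 'n \<Rightarrow> real) \<Rightarrow> bool" where
  "PL_condition \<alpha> f \<longleftrightarrow>
     (\<forall>x. f differentiable (at x)) \<and> attains_min f \<and>
     (\<exists>\<mu>>0. \<forall>x. norm (grad f x) powr \<alpha> \<ge> \<mu> * (f x - min_value f))"

end

theory Submission
  imports Defs
begin

text \<open>
  Write \<open>m\<close> for the minimum value. By the PL condition every critical point is a global minimum,
  and \<open>g = (f - m) powr (1 - 1/\<alpha>)\<close> has slope bounded below by some \<open>k > 0\<close> off the set of minima.
  Minimising \<open>g x + (k/2) * norm (x - x0)\<close> over \<open>x\<close> (a finite-dimensional Ekeland principle) then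
  produces a minimum of \<open>f\<close> within distance \<open>2 * g x0 / k\<close> of \<open>x0\<close>; as the set of minima is bounded,
  all sublevel sets are compact.

  If a sublevel set at a level \<open>c > m\<close> split into two nonempty closed pieces, each piece would contain
  a local, hence global, minimum of \<open>f\<close>. But a mountain pass argument joins any two minima \<open>p\<close>, \<open>q\<close> by a
  connected set inside every such sublevel set: otherwise let \<open>s > m\<close> be the infimum of the levels at which
  \<open>p\<close> and \<open>q\<close> can be joined. There are no critical points near level \<open>s\<close>, so one gradient step
  \<open>x \<mapsto> x - t * grad f x\<close> moves a connected set just above level \<open>s\<close> to a connected set below it,
  while fixing \<open>p\<close> and \<open>q\<close>. Finally, the set of minima is a nested intersection of compact
  connected sublevel sets.
\<close>

section \<open>Derivatives along lines and slopes at minimisers\<close>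

lemma GDERIV_along_line:
  assumes "GDERIV f (x + t *\<^sub>R v) :> D"
  shows "((\<lambda>t. f (x + t *\<^sub>R v)) has_real_derivative inner v D) (at t)"
proof -
  have "((\<lambda>t. x + t *\<^sub>R v) has_derivative (\<lambda>h. h *\<^sub>R v)) (at t)"
    by (auto intro!: derivative_eq_intros)
  from has_derivative_compose[OF this assms[unfolded gderiv_def]]
  show ?thesis
    by (simp add: has_field_derivative_def mult.commute[of _ "inner v D"] mult_commute_abs)
qed

lemma GDERIV_local_min_imp_zero:
  fixes f :: "'a::real_inner \<Rightarrow> real"
  assumes "GDERIV f x :> D" "\<forall>\<^sub>F y in nhds x. f x \<le> f y"
  shows "D = 0"
proof -
  obtain e where "e > 0" "\<forall>y\<in>ball x e. f x \<le> f y"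
    using assms(2) by (auto simp: eventually_nhds_metric dist_commute)
  then have "(\<lambda>h. inner h D) = (\<lambda>h. 0)"
    using differential_zero_maxmin[of x "ball x e" f "\<lambda>h. inner h D"] assms(1)
    by (auto simp: gderiv_def)
  then show ?thesis
    by (metis inner_eq_zero_iff)
qed

text \<open>Moving from \<open>y\<close> along \<open>- D\<close> lowers \<open>g\<close> at rate
  \<open>norm D\<close> squared, while the penalty grows at rate \<open>k * norm D\<close> only. If
  \<open>norm D\<close> exceeded \<open>k\<close>, a short move would lower the sum, although
  \<open>y\<close> minimises it.\<close>

lemma norm_GDERIV_le:
  fixes g :: "'a::real_inner \<Rightarrow> real"
  assumes D: "GDERIV g y :> D" and "k \<ge> 0"
    and le: "\<And>x. g y \<le> g x + k * norm (x - y)"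
  shows "norm D \<le> k"
proof (rule ccontr)
  assume "\<not> norm D \<le> k"
  then have k: "k < norm D" by simp
  then have pos: "norm D > 0"
    using \<open>k \<ge> 0\<close> by linarith
  have "((\<lambda>t. g (y + t *\<^sub>R (- D))) has_real_derivative inner (- D) D) (at 0)"
    by (rule GDERIV_along_line) (use D in simp)
  then have "((\<lambda>t. g (y + t *\<^sub>R (- D)) + k * t * norm D)
      has_real_derivative inner (- D) D + k * norm D) (at 0)"
    by (auto intro!: derivative_eq_intros)
  moreover have "inner (- D) D + k * norm D < 0"
    using k pos by (simp add: power2_norm_eq_inner[symmetric] power2_eq_square)
  ultimately obtain d where "d > 0" and d: "\<forall>h>0. h < d \<longrightarrow>
      g (y + 0 *\<^sub>R (- D)) + k * 0 * norm D > g (y + (0 + h) *\<^sub>R (- D)) + k * (0 + h) * norm D"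
    using DERIV_neg_dec_right by blast
  from d[rule_format, of "d/2"] le[of "y - (d/2) *\<^sub>R D"] \<open>d > 0\<close> show False
    by simp
qed

section \<open>Error bound and bounded sublevel sets\<close>

text \<open>At a minimiser \<open>y\<close> of \<open>h\<close> the slope of \<open>g\<close> is at
  most \<open>k\<close>, which steepness permits only where \<open>g\<close> vanishes; comparing
  \<open>h y\<close> with \<open>h x0\<close> bounds the distance.\<close>

lemma steep_imp_error_bound:
  fixes g :: "'a::euclidean_space \<Rightarrow> real"
  assumes cont: "continuous_on UNIV g" and nonneg: "\<And>x. g x \<ge> 0" and "k > 0"
    and steep: "\<And>x. g x > 0 \<Longrightarrow> \<exists>D. GDERIV g x :> D \<and> norm D > k"
  obtains y where "g y = 0" "k * norm (y - x0) \<le> g x0"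
proof -
  define h where "h x = g x + k * norm (x - x0)" for x
  \<comment> \<open>Outside this ball the penalty alone exceeds \<open>g x0 = h x0\<close>, so a
    minimiser over the compact ball is a global one.\<close>
  define B where "B = cball x0 (g x0 / k)"
  have "x0 \<in> B"
    using nonneg \<open>k > 0\<close> by (simp add: B_def)
  have "continuous_on B h"
    unfolding h_def by (intro continuous_intros continuous_on_subset[OF cont]) auto
  then obtain y where "y \<in> B" and ymin: "\<And>x. x \<in> B \<Longrightarrow> h y \<le> h x"
    using continuous_attains_inf[of B h] \<open>x0 \<in> B\<close> by (auto simp: B_def)
  have y0: "h y \<le> g x0"
    using ymin[OF \<open>x0 \<in> B\<close>] by (simp add: h_def)
  have "h y \<le> h x" for x
  proof (cases "x \<in> B")
    case False
    then have "g x0 < k * norm (x - x0)"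
      using \<open>k > 0\<close> by (simp add: B_def dist_norm norm_minus_commute field_simps)
    then show ?thesis
      using y0 nonneg[of x] by (simp add: h_def)
  qed (rule ymin)
  \<comment> \<open>The triangle inequality moves the centre of the penalty from \<open>x0\<close>
    to the minimiser \<open>y\<close>.\<close>
  moreover have "k * norm (x - x0) \<le> k * norm (x - y) + k * norm (y - x0)" for x
    using norm_triangle_ineq[of "x - y" "y - x0"] \<open>k > 0\<close>
    by (simp flip: distrib_left)
  ultimately have "g y \<le> g x + k * norm (x - y)" for x
    unfolding h_def by (smt (verit))
  then have "norm D \<le> k" if "GDERIV g y :> D" for D
    using norm_GDERIV_le that \<open>k > 0\<close> by (metis less_imp_le)
  then have "g y = 0"
    using steep[of y] nonneg[of y] by force
  with y0 show ?thesis
    by (intro that) (auto simp: h_def)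
qed

text \<open>The exponent \<open>1 - 1/\<alpha>\<close> is the one for which the chain rule factor
  \<open>r powr (-1/\<alpha>)\<close> cancels the PL lower bound
  \<open>(\<mu> * r) powr (1/\<alpha>)\<close> on the gradient, leaving a slope bound independent of
  \<open>r = f x - m\<close>.\<close>

lemma PL_imp_error_bound:
  fixes f :: "'a::euclidean_space \<Rightarrow> real"
  assumes "\<alpha> > 1" "\<mu> > 0" and min: "\<And>x. m \<le> f x"
    and grad: "\<And>x. GDERIV f x :> G x"
    and PL: "\<And>x. norm (G x) powr \<alpha> \<ge> \<mu> * (f x - m)"
  obtains k where "k > 0"
    "\<And>x. \<exists>y. f y = m \<and> k * norm (y - x) \<le> (f x - m) powr (1 - 1/\<alpha>)"
proof -
  define \<beta> where "\<beta> = 1 - 1/\<alpha>"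
  \<comment> \<open>Half of the slope bound, since the steepness needed is strict.\<close>
  define k where "k = \<beta> * \<mu> powr (1/\<alpha>) / 2"
  define g where "g x = (f x - m) powr \<beta>" for x
  have "\<beta> > 0"
    using \<open>\<alpha> > 1\<close> by (simp add: \<beta>_def)
  then have "k > 0"
    using \<open>\<mu> > 0\<close> by (simp add: k_def)
  have "isCont f x" for x
    using grad[of x] unfolding gderiv_def by (rule has_derivative_continuous)
  then have contf: "continuous_on UNIV f"
    by (simp add: continuous_on_eq_continuous_at)
  then have cont: "continuous_on UNIV g"
    unfolding g_def using min \<open>\<beta> > 0\<close>
    by (intro continuous_on_powr' continuous_intros) auto
  have steep: "\<exists>D. GDERIV g x :> D \<and> norm D > k" if "g x > 0" for x
  proof -
    define r where "r = f x - m"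
    \<comment> \<open>Uses that \<open>0 powr \<beta>\<close> is 0.\<close>
    have "r > 0"
      using that min[of x] by (auto simp: g_def r_def)
    have "GDERIV (\<lambda>x. f x - m) x :> G x"
      using GDERIV_diff[OF grad GDERIV_const] by simp
    then have "GDERIV g x :> (\<beta> * r powr (\<beta> - 1)) *\<^sub>R G x"
      unfolding g_def using \<open>r > 0\<close>
      by (intro GDERIV_DERIV_compose[where g = "\<lambda>z. z powr \<beta>"])
        (auto simp: r_def intro: has_real_derivative_powr)
    moreover have "norm ((\<beta> * r powr (\<beta> - 1)) *\<^sub>R G x) > k"
    proof -
      have "\<mu> * r \<le> norm (G x) powr \<alpha>"
        using PL by (simp add: r_def)
      then have "(\<mu> * r) powr (1/\<alpha>) \<le> (norm (G x) powr \<alpha>) powr (1/\<alpha>)"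
        using \<open>\<mu> > 0\<close> \<open>r > 0\<close> \<open>\<alpha> > 1\<close> by (intro powr_mono2) auto
      also have "\<dots> = norm (G x)"
        using \<open>\<alpha> > 1\<close> by (simp add: powr_powr)
      finally have "\<mu> powr (1/\<alpha>) * r powr (1/\<alpha>) \<le> norm (G x)"
        using \<open>\<mu> > 0\<close> \<open>r > 0\<close> by (simp add: powr_mult)
      then have "\<beta> * r powr (\<beta> - 1) * (\<mu> powr (1/\<alpha>) * r powr (1/\<alpha>))
          \<le> \<beta> * r powr (\<beta> - 1) * norm (G x)"
        using \<open>\<beta> > 0\<close> by (intro mult_left_mono) auto
      moreover have "r powr (\<beta> - 1) * r powr (1/\<alpha>) = 1"
        using \<open>r > 0\<close> by (simp add: \<beta>_def flip: powr_add)
      ultimately have "2 * k \<le> \<beta> * r powr (\<beta> - 1) * norm (G x)"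
        by (simp add: k_def mult_ac)
      then show ?thesis
        using \<open>k > 0\<close> \<open>\<beta> > 0\<close> by simp
    qed
    ultimately show ?thesis by blast
  qed
  have "\<exists>y. f y = m \<and> k * norm (y - x) \<le> (f x - m) powr (1 - 1/\<alpha>)" for x
  proof -
    obtain y where "g y = 0" "k * norm (y - x) \<le> g x"
      using steep_imp_error_bound[OF cont _ \<open>k > 0\<close> steep, of x] by (auto simp: g_def)
    then show ?thesis
      by (auto simp: g_def \<beta>_def)
  qed
  with \<open>k > 0\<close> show ?thesis
    by (rule that)
qed

text \<open>The error bound puts each point of the sublevel set within
  \<open>(c - m) powr (1 - 1/\<alpha>) / k\<close> of the bounded set of minima.\<close>

lemma PL_imp_bounded_sublevel:
  fixes f :: "'a::euclidean_space \<Rightarrow> real"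
  assumes "\<alpha> > 1" "\<mu> > 0" and min: "\<And>x. m \<le> f x"
    and grad: "\<And>x. GDERIV f x :> G x"
    and PL: "\<And>x. norm (G x) powr \<alpha> \<ge> \<mu> * (f x - m)"
    and bdd: "bounded {x. f x = m}"
  shows "bounded {x. f x \<le> c}"
proof -
  obtain k where "k > 0" and
    k: "\<And>x. \<exists>y. f y = m \<and> k * norm (y - x) \<le> (f x - m) powr (1 - 1/\<alpha>)"
    using PL_imp_error_bound[OF assms(1-5)] by blast
  obtain R where R: "\<And>y. f y = m \<Longrightarrow> norm y \<le> R"
    using bdd by (auto simp: bounded_iff)
  have "norm x \<le> R + (c - m) powr (1 - 1/\<alpha>) / k" if "f x \<le> c" for x
  proof -
    obtain y where y: "f y = m" "k * norm (y - x) \<le> (f x - m) powr (1 - 1/\<alpha>)"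
      using k by blast
    have "(f x - m) powr (1 - 1/\<alpha>) \<le> (c - m) powr (1 - 1/\<alpha>)"
      using \<open>\<alpha> > 1\<close> min[of x] that by (intro powr_mono2) auto
    with y(2) have "norm (y - x) \<le> (c - m) powr (1 - 1/\<alpha>) / k"
      using \<open>k > 0\<close> by (simp add: field_simps)
    then show ?thesis
      using R[OF y(1)] norm_triangle_ineq4[of y "y - x"] by simp
  qed
  then show ?thesis
    by (auto simp: bounded_iff)
qed

section \<open>Gradient steps and the mountain pass\<close>

text \<open>The mean value theorem expresses the decrease through the gradient at an intermediate
  point; uniform continuity on a compact set compares it with the gradient at \<open>x\<close>, with
  one \<open>\<delta>\<close> for all of \<open>K\<close>.\<close>

lemma gradient_step_decrease:
  fixes f :: "'a::euclidean_space \<Rightarrow> real"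
  assumes grad: "\<And>x. GDERIV f x :> G x" and contG: "continuous_on UNIV G"
    and "compact K" "\<epsilon> > 0"
  obtains \<delta> where "\<delta> > 0"
    "\<And>t x. 0 < t \<Longrightarrow> t < \<delta> \<Longrightarrow> x \<in> K \<Longrightarrow> f (x - t *\<^sub>R G x) \<le> f x - t * ((norm (G x))\<^sup>2 - \<epsilon>)"
proof -
  \<comment> \<open>\<open>\<phi> (s, x)\<close> is the rate at which \<open>f\<close> decreases
    along the step after time \<open>s\<close>; at \<open>s = 0\<close> it is the squared norm of
    \<open>G x\<close>.\<close>
  define \<phi> where "\<phi> = (\<lambda>(s::real, x). inner (G x) (G (x - s *\<^sub>R G x)))"
  have contG': "continuous_on A (\<lambda>z. G (u z))" if "continuous_on A u"
    for A :: "(real \<times> 'a) set" and u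
    by (rule continuous_on_compose2[OF contG that]) auto
  have "continuous_on ({0..1} \<times> K) \<phi>"
    unfolding \<phi>_def case_prod_beta by (intro continuous_intros contG')
  then have "uniformly_continuous_on ({0..1} \<times> K) \<phi>"
    using \<open>compact K\<close> by (intro compact_uniformly_continuous compact_Times) auto
  then obtain d where "d > 0" and
    d: "\<And>z z'. z \<in> {0..1} \<times> K \<Longrightarrow> z' \<in> {0..1} \<times> K \<Longrightarrow> dist z' z < d \<Longrightarrow> dist (\<phi> z') (\<phi> z) < \<epsilon>"
    using \<open>\<epsilon> > 0\<close> by (rule uniformly_continuous_onE) blast
  show ?thesis
  proof
    \<comment> \<open>The cap 1 keeps the intermediate time in \<open>{0..1}\<close>, where uniform
      continuity holds.\<close>
    show "min d 1 > 0"
      using \<open>d > 0\<close> by simp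
    fix t x
    assume t: "0 < t" "t < min d 1" and "x \<in> K"
    have "\<exists>s>0. s < t \<and> f (x + t *\<^sub>R (- G x)) - f (x + 0 *\<^sub>R (- G x))
        = (t - 0) * inner (- G x) (G (x + s *\<^sub>R (- G x)))"
      using t MVT2[of 0 t "\<lambda>s. f (x + s *\<^sub>R (- G x))" "\<lambda>s. inner (- G x) (G (x + s *\<^sub>R (- G x)))"]
        GDERIV_along_line[OF grad] by blast
    then obtain s where s: "0 < s" "s < t" "f (x - t *\<^sub>R G x) = f x - t * \<phi> (s, x)"
      by (auto simp: \<phi>_def algebra_simps)
    have "dist (\<phi> (s, x)) (\<phi> (0, x)) < \<epsilon>"
      using s t \<open>x \<in> K\<close> by (intro d) (auto simp: dist_Pair_Pair)
    then have "\<phi> (s, x) \<ge> (norm (G x))\<^sup>2 - \<epsilon>"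
      by (auto simp: \<phi>_def dist_real_def power2_norm_eq_inner)
    then show "f (x - t *\<^sub>R G x) \<le> f x - t * ((norm (G x))\<^sup>2 - \<epsilon>)"
      using s(3) t by simp
  qed
qed

lemma mountain_pass:
  fixes f :: "'a::euclidean_space \<Rightarrow> real"
  assumes grad: "\<And>x. GDERIV f x :> G x" and contG: "continuous_on UNIV G"
    and cpt: "\<And>c. compact {x. f x \<le> c}"
    and crit: "\<And>x. G x = 0 \<Longrightarrow> f x \<le> m"
    and pq: "G p = 0" "G q = 0" and "c > m"
  obtains K where "connected K" "p \<in> K" "q \<in> K" "K \<subseteq> {x. f x \<le> c}"
proof -
  have "isCont f x" for x
    using grad[of x] unfolding gderiv_def by (rule has_derivative_continuous)
  then have contf: "continuous_on A f" for A
    by (simp add: continuous_at_imp_continuous_on)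
  \<comment> \<open>The levels at which \<open>p\<close> and \<open>q\<close> can be joined; the
    bound \<open>m \<le> s\<close> makes the infimum meaningful.\<close>
  define S where "S = {s. m \<le> s \<and> (\<exists>K. connected K \<and> p \<in> K \<and> q \<in> K \<and> K \<subseteq> {x. f x \<le> s})}"
  obtain b where b: "\<And>x. x \<in> closed_segment p q \<Longrightarrow> f x \<le> b"
    using continuous_attains_sup[of "closed_segment p q" f] contf by auto
  have "closed_segment p q \<subseteq> {x. f x \<le> max m b}"
    using b by (auto simp: le_max_iff_disj)
  then have "max m b \<in> S"
    unfolding S_def by (auto intro!: exI[of _ "closed_segment p q"])
  then have "S \<noteq> {}" by blast
  have bdd: "bdd_below S"
    by (auto simp: S_def bdd_below_def)
  define s where "s = Inf S"
  have "s \<le> m"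
  proof (rule ccontr)
    assume "\<not> s \<le> m"
    then have "m < s" by simp
    \<comment> \<open>A compact band of levels around \<open>s\<close>, strictly above
      \<open>m\<close> and so free of critical points: the gradient is bounded away from 0 on
      it.\<close>
    define W where "W = {x. f x \<le> s + 1} \<inter> {x. (s + m) / 2 \<le> f x}"
    have "closed {x. (s + m) / 2 \<le> f x}"
      by (intro closed_Collect_le contf continuous_on_const)
    then have "compact W"
      unfolding W_def using cpt by (intro compact_Int_closed)
    have "\<exists>\<epsilon>>0. \<forall>x\<in>W. 2 * \<epsilon> \<le> (norm (G x))\<^sup>2"
    proof (cases "W = {}")
      case False
      have "continuous_on W (\<lambda>x. (norm (G x))\<^sup>2)"
        by (intro continuous_intros continuous_on_subset[OF contG]) auto
      then obtain w where "w \<in> W" "\<forall>x\<in>W. (norm (G w))\<^sup>2 \<le> (norm (G x))\<^sup>2"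
        using continuous_attains_inf[OF \<open>compact W\<close> False] by blast
      moreover have "G w \<noteq> 0"
        using crit[of w] \<open>w \<in> W\<close> \<open>m < s\<close> by (auto simp: W_def)
      ultimately show ?thesis
        by (intro exI[of _ "(norm (G w))\<^sup>2 / 2"]) auto
    qed (auto intro: exI[of _ 1])
    then obtain \<epsilon> where "\<epsilon> > 0" and \<epsilon>: "\<And>x. x \<in> W \<Longrightarrow> 2 * \<epsilon> \<le> (norm (G x))\<^sup>2"
      by blast
    obtain \<delta> where "\<delta> > 0" and
      \<delta>: "\<And>t x. 0 < t \<Longrightarrow> t < \<delta> \<Longrightarrow> x \<in> {x. f x \<le> s + 1} \<Longrightarrow>
        f (x - t *\<^sub>R G x) \<le> f x - t * ((norm (G x))\<^sup>2 - \<epsilon>)"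
      by (rule gradient_step_decrease[OF grad contG cpt[of "s + 1"] \<open>\<epsilon> > 0\<close>], rule that)
    \<comment> \<open>The second bound gives \<open>t * \<epsilon> \<le> (s - m) / 8\<close>, so
      that a point below the band, even if raised by \<open>t * \<epsilon>\<close>, ends at most at
      \<open>s - t * \<epsilon> / 2\<close>.\<close>
    define t where "t = min (\<delta> / 2) ((s - m) / (8 * \<epsilon>))"
    have t: "0 < t" "t < \<delta>"
      using \<open>\<delta> > 0\<close> \<open>\<epsilon> > 0\<close> \<open>m < s\<close> by (auto simp: t_def)
    have "t \<le> (s - m) / (8 * \<epsilon>)"
      by (simp add: t_def)
    then have t\<epsilon>: "t * \<epsilon> \<le> (s - m) / 8"
      using \<open>\<epsilon> > 0\<close> by (simp add: field_simps)
    have "t * \<epsilon> > 0"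
      using t \<open>\<epsilon> > 0\<close> by simp
    \<comment> \<open>From a level below \<open>s + t * \<epsilon> / 2\<close>, a drop of
      \<open>t * \<epsilon>\<close> ends below \<open>s - t * \<epsilon> / 2\<close>; staying below
      \<open>s + 1\<close> keeps \<open>K\<close> where \<open>\<delta>\<close> applies.\<close>
    then have "Inf S < s + min 1 (t * \<epsilon> / 2)"
      by (simp add: s_def)
    then obtain a where "a \<in> S" "a < s + min 1 (t * \<epsilon> / 2)"
      using cInf_lessD[OF \<open>S \<noteq> {}\<close>] by blast
    then obtain K where K: "connected K" "p \<in> K" "q \<in> K" "K \<subseteq> {x. f x \<le> a}"
      and a: "a < s + 1" "a < s + t * \<epsilon> / 2"
      by (auto simp: S_def)
    define T where "T x = x - t *\<^sub>R G x" for x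
    have "continuous_on K T"
      unfolding T_def by (intro continuous_intros continuous_on_subset[OF contG]) auto
    then have connT: "connected (T ` K)"
      using K(1) by (rule connected_continuous_image)
    have "T p = p" "T q = q"
      using pq by (simp_all add: T_def)
    then have pqT: "p \<in> T ` K" "q \<in> T ` K"
      using K by (metis imageI)+
    have "f (T x) \<le> s - t * \<epsilon> / 2" if "x \<in> K" for x
    proof -
      have "f x \<le> a"
        using K that by auto
      then have step: "f (T x) \<le> f x - t * ((norm (G x))\<^sup>2 - \<epsilon>)"
        unfolding T_def using a by (intro \<delta> t) auto
      show ?thesis
      proof (cases "x \<in> W")
        case True
        then have "t * \<epsilon> \<le> t * ((norm (G x))\<^sup>2 - \<epsilon>)"
          using \<epsilon>[OF True] t by (intro mult_left_mono) auto
        then show ?thesis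
          using step \<open>f x \<le> a\<close> a by linarith
      next
        case False
        then have "f x \<le> (s + m) / 2"
          using \<open>f x \<le> a\<close> a by (auto simp: W_def)
        \<comment> \<open>Below the band the gradient may be small and the step may raise
          \<open>f\<close>, but by at most \<open>t * \<epsilon>\<close>.\<close>
        moreover have "t * (- \<epsilon>) \<le> t * ((norm (G x))\<^sup>2 - \<epsilon>)"
          using t by (intro mult_left_mono) auto
        ultimately have "f (T x) \<le> (s + m) / 2 + t * \<epsilon>"
          using step by linarith
        then show ?thesis
          using t\<epsilon> \<open>m < s\<close> by (simp add: field_simps)
      qed
    qed
    then have "T ` K \<subseteq> {x. f x \<le> s - t * \<epsilon> / 2}"
      by blast
    moreover have "m \<le> s - t * \<epsilon> / 2"
      using t\<epsilon> \<open>m < s\<close> by (simp add: field_simps)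
    ultimately have "s - t * \<epsilon> / 2 \<in> S"
      unfolding S_def using connT pqT by blast
    then have "s \<le> s - t * \<epsilon> / 2"
      unfolding s_def using bdd by (rule cInf_lower)
    with \<open>t * \<epsilon> > 0\<close> show False
      by simp
  qed
  then obtain a where "a \<in> S" "a < c"
    using cInf_lessD[OF \<open>S \<noteq> {}\<close>, of c] \<open>c > m\<close> by (auto simp: s_def)
  then obtain K where "connected K" "p \<in> K" "q \<in> K" "K \<subseteq> {x. f x \<le> a}"
    by (auto simp: S_def)
  with \<open>a < c\<close> show ?thesis
    by (intro that[of K]) auto
qed

section \<open>Connectedness of sublevel sets\<close>

text \<open>A minimiser \<open>p\<close> of \<open>f\<close> on the compact piece \<open>A\<close>
  has a neighbourhood missing the closed set \<open>B\<close>. Points there lie in \<open>A\<close>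
  or above level \<open>c\<close>, so \<open>p\<close> is a local minimum in the whole
  space.\<close>

lemma sublevel_piece_has_critical_point:
  fixes f :: "'a::euclidean_space \<Rightarrow> real"
  assumes grad: "\<And>x. GDERIV f x :> G x"
    and cpt: "compact {x. f x \<le> c}"
    and AB: "closed A" "closed B" "A \<union> B = {x. f x \<le> c}" "A \<inter> B = {}" "A \<noteq> {}"
  obtains p where "p \<in> A" "G p = 0"
proof -
  have "isCont f x" for x
    using grad[of x] unfolding gderiv_def by (rule has_derivative_continuous)
  then have contf: "continuous_on A f"
    by (simp add: continuous_at_imp_continuous_on)
  have "compact ({x. f x \<le> c} \<inter> A)"
    using cpt \<open>closed A\<close> by (rule compact_Int_closed)
  moreover have "{x. f x \<le> c} \<inter> A = A"
    using AB by blast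
  ultimately obtain p where p: "p \<in> A" "\<And>x. x \<in> A \<Longrightarrow> f p \<le> f x"
    using continuous_attains_inf[OF _ \<open>A \<noteq> {}\<close> contf] by auto
  have "p \<in> - B"
    using p AB by blast
  then have "\<forall>\<^sub>F x in nhds p. x \<in> - B"
    using \<open>closed B\<close> by (intro eventually_nhds_in_open) auto
  then have "\<forall>\<^sub>F x in nhds p. f p \<le> f x"
  proof (rule eventually_mono)
    fix x assume "x \<in> - B"
    show "f p \<le> f x"
    proof (cases "x \<in> A")
      case False
      then have "\<not> f x \<le> c" "f p \<le> c"
        using \<open>x \<in> - B\<close> p AB by blast+
      then show ?thesis by simp
    qed (rule p)
  qed
  then have "G p = 0"
    using grad by (rule GDERIV_local_min_imp_zero[rotated])
  with p show ?thesis
    by (intro that)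
qed

text \<open>The PL condition enters only through two consequences: sublevel sets are compact and
  critical points are global minima.\<close>

lemma connected_sublevel:
  fixes f :: "'a::euclidean_space \<Rightarrow> real"
  assumes grad: "\<And>x. GDERIV f x :> G x" and contG: "continuous_on UNIV G"
    and cpt: "\<And>c. compact {x. f x \<le> c}"
    and min: "\<And>x. m \<le> f x" and crit: "\<And>x. G x = 0 \<Longrightarrow> f x = m"
  shows "connected {x. f x \<le> c}"
proof -
  have gt: "connected {x. f x \<le> c}" if "c > m" for c
  proof (rule ccontr)
    assume "\<not> connected {x. f x \<le> c}"
    then obtain A B where AB: "closed A" "closed B" "A \<noteq> {}" "B \<noteq> {}"
      "A \<union> B = {x. f x \<le> c}" "A \<inter> B = {}"
      unfolding connected_closed_set[OF compact_imp_closed[OF cpt]] by blast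
    obtain p where p: "p \<in> A" "G p = 0"
      by (rule sublevel_piece_has_critical_point[OF grad cpt AB(1,2,5,6,3)])
    have BA: "B \<union> A = {x. f x \<le> c}" "B \<inter> A = {}"
      using AB by blast+
    obtain q where q: "q \<in> B" "G q = 0"
      by (rule sublevel_piece_has_critical_point[OF grad cpt AB(2,1) BA AB(4)])
    obtain K where "connected K" "p \<in> K" "q \<in> K" "K \<subseteq> {x. f x \<le> c}"
      by (rule mountain_pass[OF grad contG cpt eq_refl[OF crit] p(2) q(2) \<open>c > m\<close>])
    then have "A \<inter> K = {} \<or> B \<inter> K = {}"
      using AB by (intro connected_closedD) auto
    then show False
      using p q \<open>p \<in> K\<close> \<open>q \<in> K\<close> by blast
  qed
  consider "c < m" | "c = m" | "c > m" by linarith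
  then show ?thesis
  proof cases
    case 1
    then have "{x. f x \<le> c} = {}"
      using min by (auto simp: not_le intro: less_le_trans)
    then show ?thesis by simp
  next
    case 2
    \<comment> \<open>The levels \<open>m + 1 / Suc n\<close> exceed \<open>m\<close>, so the strict
      case covers them, and they decrease to \<open>m\<close>.\<close>
    have "connected (\<Inter> (range (\<lambda>n::nat. {x. f x \<le> m + 1 / Suc n})))"
    proof (rule connected_nest)
      show "compact {x. f x \<le> m + 1 / Suc n}" for n
        by (rule cpt)
      show "connected {x. f x \<le> m + 1 / Suc n}" for n
        by (rule gt) simp
      show "{x. f x \<le> m + 1 / Suc n} \<subseteq> {x. f x \<le> m + 1 / Suc k}" if "k \<le> n" for k n
      proof -
        have "1 / real (Suc n) \<le> 1 / real (Suc k)"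
          using that by (intro frac_le) auto
        then show ?thesis by force
      qed
    qed
    moreover have "f x \<le> m" if "\<forall>n::nat. f x \<le> m + 1 / Suc n" for x
    proof (rule field_le_epsilon)
      fix e :: real assume "e > 0"
      then obtain n where "1 / Suc n < e"
        using nat_approx_posE by blast
      then show "f x \<le> m + e"
        using that[rule_format, of n] by simp
    qed
    then have "\<Inter> (range (\<lambda>n::nat. {x. f x \<le> m + 1 / Suc n})) = {x. f x \<le> m}"
      by (auto intro: add_increasing2)
    ultimately show ?thesis
      using 2 by simp
  qed (rule gt)
qed

theorem proposition1:
  fixes f :: "real ^ 'n \<Rightarrow> real" and \<alpha> :: real
  assumes "\<alpha> > 1"
    and "continuously_differentiable f"
    and "PL_condition \<alpha> f"
    and "bounded {x. f x = min_value f}"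
  shows "(\<forall>c::real. connected {x. f x \<le> c}) \<and> connected {x. f x = min_value f}"
proof -
  have grad: "GDERIV f x :> grad f x" for x
    using assms(2) by (intro GDERIV_grad) (simp add: continuously_differentiable_def)
  have contG: "continuous_on UNIV (grad f)"
    using assms(2) by (simp add: continuously_differentiable_def)
  obtain \<mu> where "\<mu> > 0" and PL: "\<And>x. norm (grad f x) powr \<alpha> \<ge> \<mu> * (f x - min_value f)"
    using assms(3) by (auto simp: PL_condition_def)
  have min: "min_value f \<le> f x" for x
    using assms(3) min_value_eqI by (metis PL_condition_def attains_min_def)
  have "isCont f x" for x
    using grad[of x] unfolding gderiv_def by (rule has_derivative_continuous)
  then have contf: "continuous_on UNIV f"
    by (simp add: continuous_on_eq_continuous_at)
  have cpt: "compact {x. f x \<le> c}" for c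
    unfolding compact_eq_bounded_closed
    using PL_imp_bounded_sublevel[OF \<open>\<alpha> > 1\<close> \<open>\<mu> > 0\<close> min grad PL assms(4)]
    by (auto intro!: closed_Collect_le contf)
  \<comment> \<open>At a critical point the left side of the PL inequality is
    \<open>0 powr \<alpha>\<close>, which is 0.\<close>
  have crit: "f x = min_value f" if "grad f x = 0" for x
  proof -
    have "\<mu> * (f x - min_value f) \<le> 0"
      using PL[of x] that by simp
    then show ?thesis
      using \<open>\<mu> > 0\<close> min[of x] by (simp add: mult_le_0_iff)
  qed
  have conn: "connected {x. f x \<le> c}" for c
    using connected_sublevel[OF grad contG cpt min crit] .
  \<comment> \<open>The set of minima is itself a sublevel set, so the second claim is an instance
    of the first.\<close>
  moreover have "{x. f x = min_value f} = {x. f x \<le> min_value f}"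
    using min by (auto intro: antisym)
  ultimately show ?thesis
    by simp
qed

end
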